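(* Let $L, R$ be non-empty subsets of a group $G$, let $x,y\in G$, and let $\sigma\in\mathrm{Aut}(G)$. (a) If at least one of the pairs $(L,R)$, $(R,L)$, $(L^{\sigma},R^{\sigma})$, $(L^{x},R^{y})$ has the $2$S-Cayley property, then they all do. (b) Suppose that $(L,R)$ has the $2$S-Cayley property. Then $$\mathrm{2SCay}(G;L,R)\cong \mathrm{2SCay}(G;R,L)\cong \mathrm{2SCay}(G;L^{\sigma},R^{\sigma})\cong \mathrm{2SCay}(G;L^x,R^y)$$ as graphs.
   Context: Let $G$ be a group with identity $e$; for $X\subseteq G$ and $g\in G$ write $X^{-1}=\{x^{-1}: x\in X\}$, $X^g=g^{-1}Xg$, and $XY=\{xy: x\in X, y\in Y\}$. For $\sigma\in\mathrm{Aut}(G)$, $X^\sigma$ is the image of $X$ under $\sigma$. For non-empty subsets $L,R$ of $G$, the two-sided Cayley graph $\mathrm{2SCay}(G;L,R)$ is the directed graph with vertex set $G$ with an arc from $x$ to $y$ if and only if $y=\ell^{-1}xr$ for some $\ell\in L$, $r\in R$. If the adjacency relation is symmetric, it is regarded as an undirected graph. A pair $(L,R)$ of subsets of $G$ has the $2$S-Cayley property if both $L,R$ are non-empty and: (1) $L^{-1}gR=LgR^{-1}$ for each $g\in G$ (this makes the adjacency relation symmetric); (2) $L^g\cap R=\varnothing$ for each $g\in G$; (3) $(LL^{-1})^g\cap (RR^{-1})=\{e\}$ for each $g\in G$. *)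

theory Defs
  imports
    "HOL-Algebra.Bij"
    "HOL-Algebra.Coset"
    "Graph_Theory.Pair_Digraph"
    "Graph_Theory.Digraph_Isomorphism"
begin

definition conjugate_set :: "('a, 'b) monoid_scheme \<Rightarrow> 'a set \<Rightarrow> 'a \<Rightarrow> 'a set" where
  "conjugate_set G X g = (inv\<^bsub>G\<^esub> g <#\<^bsub>G\<^esub> X) #>\<^bsub>G\<^esub> g"

text \<open>A directed graph without parallel arcs, given by its adjacency relation. If that relation
  is symmetric, the same object represents the undirected graph, as usual in Graph_Theory.\<close>

definition two_sided_cayley ::
  "('a, 'b) monoid_scheme \<Rightarrow> 'a set \<Rightarrow> 'a set \<Rightarrow> ('a, 'a \<times> 'a) pre_digraph" where
  "two_sided_cayley G L R = with_proj \<lparr>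
     pverts = carrier G,
     parcs = {(x, y). x \<in> carrier G \<and> y \<in> carrier G \<and>
                (\<exists>l\<in>L. \<exists>r\<in>R. y = inv\<^bsub>G\<^esub> l \<otimes>\<^bsub>G\<^esub> x \<otimes>\<^bsub>G\<^esub> r)} \<rparr>"

definition two_S_cayley_property :: "('a, 'b) monoid_scheme \<Rightarrow> 'a set \<Rightarrow> 'a set \<Rightarrow> bool" where
  "two_S_cayley_property G L R \<longleftrightarrow>
     L \<subseteq> carrier G \<and> R \<subseteq> carrier G \<and> L \<noteq> {} \<and> R \<noteq> {} \<and>
     (\<forall>g\<in>carrier G. (set_inv\<^bsub>G\<^esub> L #>\<^bsub>G\<^esub> g) <#>\<^bsub>G\<^esub> R = (L #>\<^bsub>G\<^esub> g) <#>\<^bsub>G\<^esub> (set_inv\<^bsub>G\<^esub> R)) \<and>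
     (\<forall>g\<in>carrier G. conjugate_set G L g \<inter> R = {}) \<and>
     (\<forall>g\<in>carrier G.
        conjugate_set G (L <#>\<^bsub>G\<^esub> (set_inv\<^bsub>G\<^esub> L)) g \<inter> (R <#>\<^bsub>G\<^esub> (set_inv\<^bsub>G\<^esub> R)) = {\<one>\<^bsub>G\<^esub>})"

end

theory Submission
  imports Defs
begin

text \<open>
  Write $g \cdot (l, r) = l^{-1} g r$ for the step from a vertex \<open>g\<close> that the pair \<open>(l, r)\<close> labels.
  Everything in the theorem can be phrased through these labelled steps. The three conditions of
  the 2S-Cayley property say that the arc relation is symmetric, that it has no loops, and that the
  steps from any one vertex with different labels lead to different vertices
  (\<open>two_S_cayley_property_iff\<close>).

  Hence a bijection \<open>\<theta>\<close> of the vertex set, together with a bijection \<open>\<phi>\<close> of labels satisfying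
  $\theta(g \cdot p) = \theta(g) \cdot \phi(p)$, carries one graph isomorphically to the other and
  transports the property in both directions (\<open>digraph_iso_intertwined\<close>,
  \<open>two_S_cayley_property_intertwined\<close>). Each of the three modifications of \<open>(L, R)\<close> comes with such
  a pair of maps:
  \<^item> for exchanging \<open>L\<close> and \<open>R\<close>, inversion, because $(l^{-1} g r)^{-1} = r^{-1} g^{-1} l$;
  \<^item> for an automorphism \<open>\<sigma>\<close>, the map \<open>\<sigma>\<close> itself;
  \<^item> for conjugating \<open>L\<close> by \<open>x\<close> and \<open>R\<close> by \<open>y\<close>, the map $g \mapsto x^{-1} g y$, because
    $x^{-1} (l^{-1} g r) y = (x^{-1} l x)^{-1} (x^{-1} g y) (y^{-1} r y)$.
\<close>

section \<open>The 2S-Cayley property as a property of labelled steps\<close>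

definition two_sided_step :: "('a, 'b) monoid_scheme \<Rightarrow> 'a \<Rightarrow> 'a \<times> 'a \<Rightarrow> 'a" where
  "two_sided_step G g p = inv\<^bsub>G\<^esub> (fst p) \<otimes>\<^bsub>G\<^esub> g \<otimes>\<^bsub>G\<^esub> snd p"

context group
begin

lemma two_sided_step_closed:
  assumes "L \<subseteq> carrier G" "R \<subseteq> carrier G" "g \<in> carrier G" "p \<in> L \<times> R"
  shows "two_sided_step G g p \<in> carrier G"
  using assms by (auto simp: two_sided_step_def subset_iff)

lemma arcs_two_sided_cayley:
  assumes "L \<subseteq> carrier G" "R \<subseteq> carrier G"
  shows "arcs (two_sided_cayley G L R) =
    {(g, h). g \<in> carrier G \<and> (\<exists>p\<in>L \<times> R. h = two_sided_step G g p)}"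
  using assms by (fastforce simp: two_sided_cayley_def two_sided_step_def)

lemma wf_two_sided_cayley: "wf_digraph (two_sided_cayley G L R)"
  by unfold_locales (auto simp: two_sided_cayley_def)

lemma step_eq_iff_back:
  assumes "l \<in> carrier G" "r \<in> carrier G" "g \<in> carrier G" "h \<in> carrier G"
  shows "g = two_sided_step G h (l, r) \<longleftrightarrow> h = l \<otimes> g \<otimes> inv r"
proof -
  have "g = inv l \<otimes> h \<otimes> r \<longleftrightarrow> g \<otimes> inv r = inv l \<otimes> h"
    using assms by (metis inv_closed inv_solve_right' m_closed)
  also have "\<dots> \<longleftrightarrow> l \<otimes> (g \<otimes> inv r) = h"
    using assms by (metis inv_closed inv_solve_left m_closed)
  finally show ?thesis using assms by (auto simp: two_sided_step_def m_assoc)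
qed

lemma conjugate_set_eq_image:
  "conjugate_set G X g = (\<lambda>z. inv g \<otimes> z \<otimes> g) ` X"
  by (auto simp: conjugate_set_def l_coset_def r_coset_def)

text \<open>At a vertex \<open>g\<close>, the set $L^{-1} g R$ consists of the out-neighbours of \<open>g\<close>, and the set
  $L g R^{-1}$ of its in-neighbours, since $h = l g r^{-1}$ means $g = l^{-1} h r$.\<close>

lemma symmetry_condition_iff:
  assumes "L \<subseteq> carrier G" "R \<subseteq> carrier G"
  shows "(\<forall>g\<in>carrier G. (set_inv L #> g) <#> R = (L #> g) <#> (set_inv R)) \<longleftrightarrow>
    sym (arcs (two_sided_cayley G L R))"
proof -
  define A where "A = arcs (two_sided_cayley G L R)"
  have A_sub: "A \<subseteq> carrier G \<times> carrier G"
    by (auto simp: A_def two_sided_cayley_def)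
  have out: "(set_inv L #> g) <#> R = {h. (g, h) \<in> A}" if "g \<in> carrier G" for g
    using that
    by (auto simp: A_def arcs_two_sided_cayley[OF assms] two_sided_step_def set_mult_def
        r_coset_def SET_INV_def)
  have into: "(L #> g) <#> (set_inv R) = {h. (h, g) \<in> A}" if g: "g \<in> carrier G" for g
  proof -
    have "h \<in> (L #> g) <#> (set_inv R) \<longleftrightarrow> (\<exists>l\<in>L. \<exists>r\<in>R. h = l \<otimes> g \<otimes> inv r)" for h
      by (auto simp: set_mult_def r_coset_def SET_INV_def)
    moreover have "(\<exists>l\<in>L. \<exists>r\<in>R. h = l \<otimes> g \<otimes> inv r) \<longleftrightarrow> h \<in> carrier G \<and>
        (\<exists>l\<in>L. \<exists>r\<in>R. g = two_sided_step G h (l, r))" for h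
    proof (cases "h \<in> carrier G")
      case True
      then have "(\<exists>l\<in>L. \<exists>r\<in>R. h = l \<otimes> g \<otimes> inv r) \<longleftrightarrow>
          (\<exists>l\<in>L. \<exists>r\<in>R. g = two_sided_step G h (l, r))"
        using g assms by (intro bex_cong refl) (simp add: step_eq_iff_back subset_iff)
      with True show ?thesis by simp
    next
      case False
      then show ?thesis using g assms by (auto simp: subset_iff)
    qed
    ultimately show ?thesis
      by (auto simp: A_def arcs_two_sided_cayley[OF assms])
  qed
  show ?thesis
    unfolding A_def[symmetric] sym_def using out into A_sub by (auto; blast)
qed

text \<open>A step with label \<open>(l, r)\<close> fixes \<open>g\<close> exactly when $l g = g r$, that is, when \<open>g\<close> conjugates \<open>l\<close>
  into \<open>r\<close>.\<close>

lemma loopless_condition_iff: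
  assumes "L \<subseteq> carrier G" "R \<subseteq> carrier G"
  shows "(\<forall>g\<in>carrier G. conjugate_set G L g \<inter> R = {}) \<longleftrightarrow>
    irrefl (arcs (two_sided_cayley G L R))"
proof -
  have "inv g \<otimes> l \<otimes> g = r \<longleftrightarrow> g = two_sided_step G g (l, r)"
    if "g \<in> carrier G" "l \<in> L" "r \<in> R" for g l r
  proof -
    have c: "l \<in> carrier G" "r \<in> carrier G" using that assms by auto
    have "inv g \<otimes> l \<otimes> g = r \<longleftrightarrow> l \<otimes> g = g \<otimes> r"
      using c that by (metis inv_closed inv_solve_left m_assoc m_closed)
    also have "\<dots> \<longleftrightarrow> g = l \<otimes> g \<otimes> inv r"
      using c that by (metis inv_solve_right m_closed)
    finally show ?thesis using step_eq_iff_back c that by simp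
  qed
  then show ?thesis
    by (fastforce simp: irrefl_def arcs_two_sided_cayley[OF assms] conjugate_set_eq_image)
qed

lemma step_eq_step_iff:
  assumes "l \<in> carrier G" "r \<in> carrier G" "l' \<in> carrier G" "r' \<in> carrier G" "g \<in> carrier G"
  shows "two_sided_step G g (l', r') = two_sided_step G g (l, r) \<longleftrightarrow>
    inv g \<otimes> (l \<otimes> inv l') \<otimes> g = r \<otimes> inv r'"
proof -
  have "two_sided_step G g (l', r') = two_sided_step G g (l, r) \<longleftrightarrow>
      inv l' \<otimes> g \<otimes> r' = inv l \<otimes> (g \<otimes> r)"
    using assms by (simp add: two_sided_step_def m_assoc)
  also have "\<dots> \<longleftrightarrow> l \<otimes> (inv l' \<otimes> g \<otimes> r') = g \<otimes> r"
    using assms by (metis inv_closed inv_solve_left m_closed)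
  also have "\<dots> \<longleftrightarrow> (l \<otimes> inv l' \<otimes> g) \<otimes> r' = g \<otimes> r"
    using assms by (simp add: m_assoc)
  also have "\<dots> \<longleftrightarrow> l \<otimes> inv l' \<otimes> g = g \<otimes> (r \<otimes> inv r')"
    using assms by (metis inv_closed inv_solve_right m_assoc m_closed)
  also have "\<dots> \<longleftrightarrow> inv g \<otimes> (l \<otimes> inv l') \<otimes> g = r \<otimes> inv r'"
    using assms by (metis inv_closed inv_solve_left m_assoc m_closed)
  finally show ?thesis .
qed

text \<open>By \<open>step_eq_step_iff\<close>, the elements of the intersection are the products $r r'^{-1}$ that
  arise from two labels with the same step from \<open>g\<close>. The intersection is therefore trivial exactly
  when two such labels have the same right entry; cancelling it shows that then the left entries
  agree, too.\<close>

lemma injectivity_condition_iff: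
  assumes "L \<subseteq> carrier G" "R \<subseteq> carrier G" "L \<noteq> {}" "R \<noteq> {}" "g \<in> carrier G"
  shows "conjugate_set G (L <#> (set_inv L)) g \<inter> (R <#> (set_inv R)) = {\<one>} \<longleftrightarrow>
    inj_on (two_sided_step G g) (L \<times> R)"
    (is "?I = {\<one>} \<longleftrightarrow> ?inj")
proof -
  have mem: "z \<in> ?I \<longleftrightarrow> (\<exists>l\<in>L. \<exists>l'\<in>L. \<exists>r\<in>R. \<exists>r'\<in>R.
      two_sided_step G g (l', r') = two_sided_step G g (l, r) \<and> z = r \<otimes> inv r')" for z
  proof -
    have "z \<in> ?I \<longleftrightarrow> (\<exists>l\<in>L. \<exists>l'\<in>L. \<exists>r\<in>R. \<exists>r'\<in>R.
        z = inv g \<otimes> (l \<otimes> inv l') \<otimes> g \<and> z = r \<otimes> inv r')"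
      by (simp add: conjugate_set_eq_image set_mult_def SET_INV_def image_iff)
    also have "\<dots> \<longleftrightarrow> (\<exists>l\<in>L. \<exists>l'\<in>L. \<exists>r\<in>R. \<exists>r'\<in>R.
        inv g \<otimes> (l \<otimes> inv l') \<otimes> g = r \<otimes> inv r' \<and> z = r \<otimes> inv r')"
      by (intro bex_cong refl) auto
    also have "\<dots> \<longleftrightarrow> (\<exists>l\<in>L. \<exists>l'\<in>L. \<exists>r\<in>R. \<exists>r'\<in>R.
      two_sided_step G g (l', r') = two_sided_step G g (l, r) \<and> z = r \<otimes> inv r')"
      using assms by (intro bex_cong refl) (simp add: step_eq_step_iff subset_iff)
    finally show ?thesis .
  qed
  have one: "\<one> \<in> ?I"
  proof -
    obtain l r where "l \<in> L" "r \<in> R" using assms by blast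
    then show ?thesis unfolding mem using assms by (metis r_inv subsetD)
  qed
  show ?thesis
  proof
    assume I: "?I = {\<one>}"
    show ?inj
    proof (rule inj_onI)
      fix p q assume p: "p \<in> L \<times> R" and q: "q \<in> L \<times> R"
        and eq: "two_sided_step G g p = two_sided_step G g q"
      obtain l r l' r' where pq: "p = (l', r')" "q = (l, r)" by (metis prod.exhaust)
      have in_L: "l \<in> L" "l' \<in> L" and in_R: "r \<in> R" "r' \<in> R" using p q pq by auto
      have c: "l \<in> carrier G" "l' \<in> carrier G" "r \<in> carrier G" "r' \<in> carrier G"
        using in_L in_R assms by auto
      have "r \<otimes> inv r' \<in> ?I" unfolding mem using in_L in_R eq pq by blast
      then have one_r: "r \<otimes> inv r' = \<one>" using I by blast
      then have "r = r'" using c by (metis inv_closed inv_equality inv_inv)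
      moreover have "l = l'"
      proof -
        have "inv l' \<otimes> g \<otimes> r = inv l \<otimes> g \<otimes> r"
          using eq pq \<open>r = r'\<close> by (simp add: two_sided_step_def)
        then have "inv l' = inv l" using c assms(5) by simp
        then show ?thesis using c by (metis inv_inv)
      qed
      ultimately show "p = q" using pq by simp
    qed
  next
    assume inj: ?inj
    have "z = \<one>" if z: "z \<in> ?I" for z
    proof -
      obtain l l' r r' where "l \<in> L" "l' \<in> L" "r \<in> R" "r' \<in> R"
        "two_sided_step G g (l', r') = two_sided_step G g (l, r)" "z = r \<otimes> inv r'"
        using z unfolding mem by blast
      then show ?thesis using inj_onD[OF inj, of "(l', r')" "(l, r)"] assms by (auto simp: subset_iff)
    qed
    then show "?I = {\<one>}" using one by blast
  qed
qed

lemma two_S_cayley_property_iff: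
  assumes "L \<subseteq> carrier G" "R \<subseteq> carrier G"
  shows "two_S_cayley_property G L R \<longleftrightarrow> L \<times> R \<noteq> {} \<and>
    sym (arcs (two_sided_cayley G L R)) \<and> irrefl (arcs (two_sided_cayley G L R)) \<and>
    (\<forall>g\<in>carrier G. inj_on (two_sided_step G g) (L \<times> R))"
proof (cases "L = {} \<or> R = {}")
  case True
  then show ?thesis by (auto simp: two_S_cayley_property_def)
next
  case False
  then show ?thesis
    unfolding two_S_cayley_property_def symmetry_condition_iff[OF assms]
      loopless_condition_iff[OF assms]
    using assms by (simp add: injectivity_condition_iff cong: ball_cong)
qed

section \<open>Maps that intertwine steps\<close>

text \<open>The map on labels acts on whole pairs rather than on each entry: inversion of the group
  exchanges the two entries.\<close>

definition step_intertwiner ::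
  "'a set \<Rightarrow> 'a set \<Rightarrow> 'a set \<Rightarrow> 'a set \<Rightarrow> ('a \<Rightarrow> 'a) \<Rightarrow> ('a \<times> 'a \<Rightarrow> 'a \<times> 'a) \<Rightarrow> bool" where
  "step_intertwiner L R L' R' \<theta> \<phi> \<longleftrightarrow>
    bij_betw \<theta> (carrier G) (carrier G) \<and> bij_betw \<phi> (L \<times> R) (L' \<times> R') \<and>
    (\<forall>g\<in>carrier G. \<forall>p\<in>L \<times> R.
       \<theta> (two_sided_step G g p) = two_sided_step G (\<theta> g) (\<phi> p))"

lemma arcs_intertwined:
  assumes sub: "L \<subseteq> carrier G" "R \<subseteq> carrier G" "L' \<subseteq> carrier G" "R' \<subseteq> carrier G"
    and "step_intertwiner L R L' R' \<theta> \<phi>"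
  shows "arcs (two_sided_cayley G L' R') = map_prod \<theta> \<theta> ` arcs (two_sided_cayley G L R)"
proof -
  have \<theta>: "carrier G = \<theta> ` carrier G" and \<phi>: "L' \<times> R' = \<phi> ` (L \<times> R)"
    and eq: "\<And>g p. g \<in> carrier G \<Longrightarrow> p \<in> L \<times> R \<Longrightarrow>
      \<theta> (two_sided_step G g p) = two_sided_step G (\<theta> g) (\<phi> p)"
    using assms(5) by (auto simp: step_intertwiner_def bij_betw_def)
  have "arcs (two_sided_cayley G L' R') =
      {(\<theta> g, two_sided_step G (\<theta> g) (\<phi> p)) | g p. g \<in> carrier G \<and> p \<in> L \<times> R}"
    unfolding arcs_two_sided_cayley[OF sub(3,4)] \<phi>
    by (subst (1) \<theta>) blast
  also have "\<dots> = {(\<theta> g, \<theta> (two_sided_step G g p)) | g p. g \<in> carrier G \<and> p \<in> L \<times> R}"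
    using eq by (metis (no_types, lifting))
  also have "\<dots> = map_prod \<theta> \<theta> ` arcs (two_sided_cayley G L R)"
    unfolding arcs_two_sided_cayley[OF sub(1,2)] by (auto simp: image_iff)
  finally show ?thesis .
qed

text \<open>Symmetry and looplessness belong to the arc relation, which \<open>\<theta>\<close> carries over. Injectivity of the
  steps from \<open>g\<close> corresponds to that of the steps from \<open>\<theta> g\<close>, since the two families differ by
  composition with the injective maps \<open>\<theta>\<close> and \<open>\<phi>\<close>.\<close>

lemma two_S_cayley_property_intertwined:
  assumes sub: "L \<subseteq> carrier G" "R \<subseteq> carrier G" "L' \<subseteq> carrier G" "R' \<subseteq> carrier G"
    and int: "step_intertwiner L R L' R' \<theta> \<phi>"
  shows "two_S_cayley_property G L R \<longleftrightarrow> two_S_cayley_property G L' R'"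
proof -
  define A A' where "A = arcs (two_sided_cayley G L R)" "A' = arcs (two_sided_cayley G L' R')"
  have A': "A' = map_prod \<theta> \<theta> ` A"
    unfolding A_A'_def by (rule arcs_intertwined[OF assms])
  have A_sub: "A \<subseteq> carrier G \<times> carrier G"
    by (auto simp: A_A'_def two_sided_cayley_def)
  have \<theta>: "inj_on \<theta> (carrier G)" "carrier G = \<theta> ` carrier G"
    and \<phi>: "inj_on \<phi> (L \<times> R)" "L' \<times> R' = \<phi> ` (L \<times> R)"
    and eq: "\<And>g p. g \<in> carrier G \<Longrightarrow> p \<in> L \<times> R \<Longrightarrow>
      \<theta> (two_sided_step G g p) = two_sided_step G (\<theta> g) (\<phi> p)"
    using int by (auto simp: step_intertwiner_def bij_betw_def)
  have mem: "(\<theta> g, \<theta> h) \<in> A' \<longleftrightarrow> (g, h) \<in> A" if "g \<in> carrier G" "h \<in> carrier G" for g h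
    using that A_sub \<theta>(1) by (force simp: A' inj_on_eq_iff)
  have "L \<times> R \<noteq> {} \<longleftrightarrow> L' \<times> R' \<noteq> {}" unfolding \<phi>(2) by blast
  moreover have "sym A \<longleftrightarrow> sym A'"
  proof -
    have A'_sub: "A' \<subseteq> carrier G \<times> carrier G"
      by (auto simp: A_A'_def two_sided_cayley_def)
    have on_carrier: "sym X \<longleftrightarrow> (\<forall>g\<in>carrier G. \<forall>h\<in>carrier G. (g, h) \<in> X \<longrightarrow> (h, g) \<in> X)"
      if "X \<subseteq> carrier G \<times> carrier G" for X
      using that unfolding sym_def by blast
    have "sym A' \<longleftrightarrow> (\<forall>g\<in>carrier G. \<forall>h\<in>carrier G. (\<theta> g, \<theta> h) \<in> A' \<longrightarrow> (\<theta> h, \<theta> g) \<in> A')"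
      unfolding on_carrier[OF A'_sub] by (subst (1 2) \<theta>(2)) blast
    then show ?thesis
      unfolding on_carrier[OF A_sub] by (simp add: mem)
  qed
  moreover have "irrefl A \<longleftrightarrow> irrefl A'"
    using A_sub \<theta>(1) unfolding irrefl_def A' by (auto dest: inj_onD)
  moreover have "inj_on (two_sided_step G g) (L \<times> R) \<longleftrightarrow>
      inj_on (two_sided_step G (\<theta> g)) (L' \<times> R')" if g: "g \<in> carrier G" for g
  proof -
    have "inj_on (two_sided_step G (\<theta> g)) (L' \<times> R') \<longleftrightarrow>
        inj_on (two_sided_step G (\<theta> g) \<circ> \<phi>) (L \<times> R)"
      unfolding \<phi>(2) using \<phi>(1) by (simp add: comp_inj_on_iff)
    also have "\<dots> \<longleftrightarrow> inj_on (\<theta> \<circ> two_sided_step G g) (L \<times> R)"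
      using eq g by (intro inj_on_cong) simp
    also have "\<dots> \<longleftrightarrow> inj_on (two_sided_step G g) (L \<times> R)"
    proof -
      have "two_sided_step G g ` (L \<times> R) \<subseteq> carrier G"
        using two_sided_step_closed[OF sub(1,2) g] by blast
      then show ?thesis
        using inj_on_subset[OF \<theta>(1)] by (meson comp_inj_on inj_on_imageI2)
    qed
    finally show ?thesis ..
  qed
  then have "(\<forall>g\<in>carrier G. inj_on (two_sided_step G g) (L \<times> R)) \<longleftrightarrow>
      (\<forall>g\<in>carrier G. inj_on (two_sided_step G g) (L' \<times> R'))"
    using \<theta>(2) by (metis (no_types, lifting) imageE imageI)
  ultimately show ?thesis
    unfolding two_S_cayley_property_iff[OF sub(1,2)] two_S_cayley_property_iff[OF sub(3,4)]
      A_A'_def by blast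
qed

lemma digraph_iso_intertwined:
  assumes sub: "L \<subseteq> carrier G" "R \<subseteq> carrier G" "L' \<subseteq> carrier G" "R' \<subseteq> carrier G"
    and int: "step_intertwiner L R L' R' \<theta> \<phi>"
  shows "digraph_iso (two_sided_cayley G L R) (two_sided_cayley G L' R')"
proof -
  define f where "f = \<lparr>iso_verts = \<theta>, iso_arcs = map_prod \<theta> \<theta>,
    iso_head = snd, iso_tail = fst\<rparr>"
  have inj: "inj_on \<theta> (carrier G)" and img: "\<theta> ` carrier G = carrier G"
    using int by (auto simp: step_intertwiner_def bij_betw_def)
  have proj: "verts (two_sided_cayley G X Y) = carrier G"
    "tail (two_sided_cayley G X Y) = fst" "head (two_sided_cayley G X Y) = snd"
    "arcs (two_sided_cayley G X Y) \<subseteq> carrier G \<times> carrier G" for X Y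
    by (auto simp: two_sided_cayley_def)
  have "pre_digraph.digraph_isomorphism (two_sided_cayley G L R) f"
    unfolding pre_digraph.digraph_isomorphism_def
    using wf_two_sided_cayley inj inj_on_subset[OF map_prod_inj_on[OF inj inj] proj(4)]
    by (simp add: f_def proj)
  moreover have "two_sided_cayley G L' R' = app_iso f (two_sided_cayley G L R)"
    using arcs_intertwined[OF assms] img
    by (intro pre_digraph.equality) (auto simp: f_def proj)
  ultimately show ?thesis unfolding digraph_iso_def by blast
qed

section \<open>Intertwiners for exchange, automorphisms and conjugation\<close>

lemma step_intertwiner_swap:
  assumes "L \<subseteq> carrier G" "R \<subseteq> carrier G"
  shows "step_intertwiner L R R L (m_inv G) prod.swap"
proof -
  have "bij_betw (m_inv G) (carrier G) (carrier G)"
    by (rule bij_betw_byWitness[where f' = "m_inv G"]) auto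
  moreover have "bij_betw prod.swap (L \<times> R) (R \<times> L)"
    by (rule bij_betw_byWitness[where f' = prod.swap]) auto
  ultimately show ?thesis
    using assms
    by (auto simp: step_intertwiner_def two_sided_step_def inv_mult_group m_assoc subset_iff)
qed

lemma step_intertwiner_auto:
  assumes "L \<subseteq> carrier G" "R \<subseteq> carrier G" "\<sigma> \<in> auto G"
  shows "step_intertwiner L R (\<sigma> ` L) (\<sigma> ` R) \<sigma> (map_prod \<sigma> \<sigma>)"
proof -
  have hom: "\<sigma> \<in> hom G G" and bij: "bij_betw \<sigma> (carrier G) (carrier G)"
    using assms(3) by (auto simp: auto_def Bij_def)
  interpret \<sigma>: group_hom G G \<sigma>
    using hom by unfold_locales
  have "bij_betw (map_prod \<sigma> \<sigma>) (L \<times> R) (\<sigma> ` L \<times> \<sigma> ` R)"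
    using bij assms by (auto simp: bij_betw_def map_prod_surj_on
        intro!: map_prod_inj_on intro: inj_on_subset)
  then show ?thesis
    using bij assms by (auto simp: step_intertwiner_def two_sided_step_def subset_iff)
qed

lemma step_intertwiner_conjugate:
  assumes "L \<subseteq> carrier G" "R \<subseteq> carrier G" and x: "x \<in> carrier G" and y: "y \<in> carrier G"
  shows "step_intertwiner L R (conjugate_set G L x) (conjugate_set G R y)
    (\<lambda>g. inv x \<otimes> g \<otimes> y) (map_prod (\<lambda>z. inv x \<otimes> z \<otimes> x) (\<lambda>z. inv y \<otimes> z \<otimes> y))"
proof -
  have cancel: "z \<otimes> (inv z \<otimes> w) = w" "inv z \<otimes> (z \<otimes> w) = w"
    if "z \<in> carrier G" "w \<in> carrier G" for z w
    using that by (simp_all add: m_assoc[symmetric])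
  have bij: "bij_betw (\<lambda>g. inv u \<otimes> g \<otimes> v) (carrier G) (carrier G)"
    if "u \<in> carrier G" "v \<in> carrier G" for u v
    using that
    by (intro bij_betw_byWitness[where f' = "\<lambda>g. u \<otimes> g \<otimes> inv v"])
       (auto simp: m_assoc cancel)
  have "bij_betw (map_prod (\<lambda>z. inv x \<otimes> z \<otimes> x) (\<lambda>z. inv y \<otimes> z \<otimes> y)) (L \<times> R)
      (conjugate_set G L x \<times> conjugate_set G R y)"
    using bij[OF x x] bij[OF y y] assms unfolding conjugate_set_eq_image
    by (auto simp: bij_betw_def map_prod_surj_on intro!: map_prod_inj_on intro: inj_on_subset)
  moreover have "inv x \<otimes> (inv l \<otimes> g \<otimes> r) \<otimes> y =
      inv (inv x \<otimes> l \<otimes> x) \<otimes> (inv x \<otimes> g \<otimes> y) \<otimes> (inv y \<otimes> r \<otimes> y)"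
    if "l \<in> carrier G" "g \<in> carrier G" "r \<in> carrier G" for l g r
    using that x y by (simp add: inv_mult_group m_assoc cancel)
  ultimately show ?thesis
    using bij[OF x y] assms by (auto simp: step_intertwiner_def two_sided_step_def subset_iff)
qed

end

section \<open>Pairs with isomorphic two-sided Cayley graphs\<close>

theorem theorem1p7:
  fixes G :: "('a, 'b) monoid_scheme"
    and L R :: "'a set" and x y :: 'a and \<sigma> :: "'a \<Rightarrow> 'a"
  assumes "group G"
    and "L \<subseteq> carrier G" and "R \<subseteq> carrier G"
    and "L \<noteq> {}" and "R \<noteq> {}"
    and "x \<in> carrier G" and "y \<in> carrier G"
    and "\<sigma> \<in> auto G"
  shows
    "(two_S_cayley_property G L R \<or>
      two_S_cayley_property G R L \<or>
      two_S_cayley_property G (\<sigma> ` L) (\<sigma> ` R) \<or>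
      two_S_cayley_property G (conjugate_set G L x) (conjugate_set G R y)
      \<longrightarrow>
      two_S_cayley_property G L R \<and>
      two_S_cayley_property G R L \<and>
      two_S_cayley_property G (\<sigma> ` L) (\<sigma> ` R) \<and>
      two_S_cayley_property G (conjugate_set G L x) (conjugate_set G R y))
     \<and>
     (two_S_cayley_property G L R
      \<longrightarrow>
      digraph_iso (two_sided_cayley G L R) (two_sided_cayley G R L) \<and>
      digraph_iso (two_sided_cayley G R L) (two_sided_cayley G (\<sigma> ` L) (\<sigma> ` R)) \<and>
      digraph_iso (two_sided_cayley G (\<sigma> ` L) (\<sigma> ` R))
        (two_sided_cayley G (conjugate_set G L x) (conjugate_set G R y)))"
proof -
  interpret group G by fact
  note L = assms(2) and R = assms(3)
  have \<sigma>_sub: "\<sigma> ` L \<subseteq> carrier G" "\<sigma> ` R \<subseteq> carrier G"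
    using assms(8) L R by (auto simp: auto_def hom_def)
  have conj_sub: "conjugate_set G L x \<subseteq> carrier G" "conjugate_set G R y \<subseteq> carrier G"
    using L R assms(6,7) by (auto simp: conjugate_set_eq_image)
  note swap = step_intertwiner_swap[OF L R]
    and \<sigma> = step_intertwiner_auto[OF L R assms(8)]
    and conj = step_intertwiner_conjugate[OF L R assms(6,7)]
  have "two_S_cayley_property G L R \<longleftrightarrow> two_S_cayley_property G R L"
    "two_S_cayley_property G L R \<longleftrightarrow> two_S_cayley_property G (\<sigma> ` L) (\<sigma> ` R)"
    "two_S_cayley_property G L R \<longleftrightarrow>
      two_S_cayley_property G (conjugate_set G L x) (conjugate_set G R y)"
    using two_S_cayley_property_intertwined[OF L R R L swap]
      two_S_cayley_property_intertwined[OF L R \<sigma>_sub \<sigma>]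
      two_S_cayley_property_intertwined[OF L R conj_sub conj] by blast+
  moreover have "digraph_iso (two_sided_cayley G L R) (two_sided_cayley G R L)"
    "digraph_iso (two_sided_cayley G L R) (two_sided_cayley G (\<sigma> ` L) (\<sigma> ` R))"
    "digraph_iso (two_sided_cayley G L R)
      (two_sided_cayley G (conjugate_set G L x) (conjugate_set G R y))"
    using digraph_iso_intertwined[OF L R R L swap]
      digraph_iso_intertwined[OF L R \<sigma>_sub \<sigma>]
      digraph_iso_intertwined[OF L R conj_sub conj] by blast+
  \<comment> \<open>All isomorphisms start at \<open>(L, R)\<close>; the chain in the theorem composes them with inverses.\<close>
  ultimately show ?thesis
    using digraph_iso_swap[OF wf_two_sided_cayley] digraph_iso_trans by blast
qed

end
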